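(* Let $\mu>0$ and let $f$ be a $\mu$-strongly convex function. Let $r>0$, $0\le\alpha\le1$, and let $\beta$ satisfy $$0\le\beta\le\begin{cases}\frac12,&0\le\alpha<1,\\ \min\{\frac23,\frac{1+r}{2r}\},&\alpha=1,\end{cases}$$ and, when $\alpha=0$, suppose in addition that $r\le\sqrt{\frac{\mu}{\beta(1-\beta)}}$ (no restriction if $\beta=0$). Let $$\xi(t)=\begin{cases}\frac{r}{1-\alpha}t^{1-\alpha},&0\le\alpha<1,\\ r\ln t,&\alpha=1,\end{cases}$$ and $$D(t)=e^{\beta\xi(t)},\qquad B(t)=\sqrt{\beta r\left[(1-\beta)rt^{1-\alpha}+\alpha\right]t^{-\alpha-1}e^{\beta\xi(t)}},$$ $$A(t)=\sqrt{\frac{\beta rt^{1-\alpha}}{(1-\beta)rt^{1-\alpha}+\alpha}\,e^{\beta\xi(t)}},\qquad C(t)=\left[1-\frac{\beta rt^{1-\alpha}}{(1-\beta)rt^{1-\alpha}+\alpha}\right]e^{\beta\xi(t)}.$$ Let $T=T(\mu,\alpha,r,\beta)$ be the largest root of $$P(t;\mu,\alpha,r,\beta)=\mu t^2-(1-\beta)\beta r^2t^{2(1-\alpha)}+(2-3\beta)r\alpha t^{1-\alpha}+\alpha(\alpha+1)$$ if $P$ has a root, and zero if $P$ has no root (for $\alpha=0$, $T=0$). Then $$L(t)=\frac12\|A(t)\dot x(t)+B(t)(x(t)-x^* )\|^2+\frac12C(t)\|\dot x(t)\|^2+D(t)\,(f(x(t))-f^* )$$ is a Lyapunov function of the equation $$\ddot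 x+\frac{r}{t^\alpha}\dot x+\nabla f(x)=0$$ when $t\ge T$.
   Context: Standing assumptions: $f:\mathbb{R}^d\to\mathbb{R}$ is twice continuously differentiable and convex, $\nabla f$ is Lipschitz continuous, $f$ has a unique minimizer $x^*$, and $f^*=f(x^* )$. Time $t$ is positive (when $\alpha=0$, $t=0$ is also allowed), and roots of $P$ are real roots in $t\ge 0$. $f$ is $\mu$-strongly convex if $f(y)-f(x)-\langle\nabla f(x),y-x\rangle\ge\frac\mu2\|y-x\|^2$ for all $x,y\in\mathbb{R}^d$. "$L(t)$ is a Lyapunov function of the equation when $t\ge T$" means: $A,B,C,D$ are well defined and nonnegative, and for any solution $x(t)$ of the equation, $\frac{d}{dt}L(t)\le0$ for those $t\ge T$ (in the domain of the solution). *)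

theory Defs
  imports "HOL-Analysis.Analysis"
begin

definition grad :: "(real^'n \<Rightarrow> real) \<Rightarrow> real^'n \<Rightarrow> real^'n" where
  "grad f x = (THE g. GDERIV f x :> g)"

definition twice_cont_differentiable :: "(real^'n \<Rightarrow> real) \<Rightarrow> bool" where
  "twice_cont_differentiable f \<longleftrightarrow>
     (\<forall>x. GDERIV f x :> grad f x) \<and>
     (\<exists>H :: real^'n \<Rightarrow> ((real^'n) \<Rightarrow>\<^sub>L (real^'n)).
        (\<forall>x. (grad f has_derivative blinfun_apply (H x)) (at x)) \<and> continuous_on UNIV H)"

definition unique_minimizer :: "(real^'n \<Rightarrow> real) \<Rightarrow> real^'n \<Rightarrow> bool" where
  "unique_minimizer f xs \<longleftrightarrow>
     (\<forall>y. f xs \<le> f y) \<and> (\<forall>z. (\<forall>y. f z \<le> f y) \<longrightarrow> z = xs)"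

definition strongly_convex :: "real \<Rightarrow> (real^'n \<Rightarrow> real) \<Rightarrow> bool" where
  "strongly_convex \<mu> f \<longleftrightarrow>
     (\<forall>x y. f y - f x - inner (grad f x) (y - x) \<ge> \<mu> / 2 * (norm (y - x))\<^sup>2)"

text \<open>Real powers of a base \<open>t \<ge> 0\<close> with \<open>t\<^sup>0 = 1\<close> also at \<open>t = 0\<close>;
  the library has \<open>0 powr 0 = 0\<close>.\<close>

definition rpow :: "real \<Rightarrow> real \<Rightarrow> real" where
  "rpow t p = (if p = 0 then 1 else t powr p)"

definition time_domain :: "real \<Rightarrow> real set" where
  "time_domain \<alpha> = (if \<alpha> = 0 then {0..} else {0<..})"

text \<open>Solutions live on arbitrary nondegenerate intervals of admissible times; derivatives
  are one-sided at endpoints that belong to the interval. \<open>v\<close> is the velocity of \<open>x\<close>.\<close>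

definition ode_solution ::
  "(real^'n \<Rightarrow> real) \<Rightarrow> real \<Rightarrow> real \<Rightarrow> real set \<Rightarrow> (real \<Rightarrow> real^'n) \<Rightarrow> (real \<Rightarrow> real^'n) \<Rightarrow> bool" where
  "ode_solution f r \<alpha> J x v \<longleftrightarrow>
     is_interval J \<and> interior J \<noteq> {} \<and> J \<subseteq> time_domain \<alpha> \<and>
     (\<exists>a. \<forall>t\<in>J. (x has_vector_derivative v t) (at t within J) \<and>
               (v has_vector_derivative a t) (at t within J) \<and>
               a t + (r / rpow t \<alpha>) *\<^sub>R v t + grad f (x t) = 0)"

definition xi :: "real \<Rightarrow> real \<Rightarrow> real \<Rightarrow> real" where
  "xi r \<alpha> t = (if \<alpha> < 1 then r / (1 - \<alpha>) * rpow t (1 - \<alpha>) else r * ln t)"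

definition den :: "real \<Rightarrow> real \<Rightarrow> real \<Rightarrow> real \<Rightarrow> real" where
  "den r \<alpha> \<beta> t = (1 - \<beta>) * r * rpow t (1 - \<alpha>) + \<alpha>"

text \<open>The time \<open>t = 0\<close> is admissible only for \<open>\<alpha> = 0\<close>. There the powers of \<open>t\<close> in the
  two expressions below cancel for all \<open>t > 0\<close>, and \<open>t = 0\<close> gets the cancelled value.\<close>

definition ratio :: "real \<Rightarrow> real \<Rightarrow> real \<Rightarrow> real \<Rightarrow> real" where
  "ratio r \<alpha> \<beta> t =
     (if t = 0 then \<beta> / (1 - \<beta>) else \<beta> * r * rpow t (1 - \<alpha>) / den r \<alpha> \<beta> t)"

definition A_rad :: "real \<Rightarrow> real \<Rightarrow> real \<Rightarrow> real \<Rightarrow> real" where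
  "A_rad r \<alpha> \<beta> t = ratio r \<alpha> \<beta> t * exp (\<beta> * xi r \<alpha> t)"

definition B_rad :: "real \<Rightarrow> real \<Rightarrow> real \<Rightarrow> real \<Rightarrow> real" where
  "B_rad r \<alpha> \<beta> t =
     (if t = 0 then \<beta> * r * ((1 - \<beta>) * r)
      else \<beta> * r * den r \<alpha> \<beta> t * rpow t (- \<alpha> - 1)) * exp (\<beta> * xi r \<alpha> t)"

lemma ratio_cancel:
  assumes "r > 0" "t > 0"
  shows "ratio r 0 \<beta> t = ratio r 0 \<beta> 0"
  using assms by (simp add: ratio_def den_def rpow_def)

lemma B_rad_cancel:
  assumes "t > 0"
  shows "\<beta> * r * den r 0 \<beta> t * rpow t (- 0 - 1) = \<beta> * r * ((1 - \<beta>) * r)"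
  using assms by (simp add: den_def rpow_def powr_minus field_simps)

definition coeff_A :: "real \<Rightarrow> real \<Rightarrow> real \<Rightarrow> real \<Rightarrow> real" where
  "coeff_A r \<alpha> \<beta> t = sqrt (A_rad r \<alpha> \<beta> t)"

definition coeff_B :: "real \<Rightarrow> real \<Rightarrow> real \<Rightarrow> real \<Rightarrow> real" where
  "coeff_B r \<alpha> \<beta> t = sqrt (B_rad r \<alpha> \<beta> t)"

definition coeff_C :: "real \<Rightarrow> real \<Rightarrow> real \<Rightarrow> real \<Rightarrow> real" where
  "coeff_C r \<alpha> \<beta> t = (1 - ratio r \<alpha> \<beta> t) * exp (\<beta> * xi r \<alpha> t)"

definition coeff_D :: "real \<Rightarrow> real \<Rightarrow> real \<Rightarrow> real \<Rightarrow> real" where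
  "coeff_D r \<alpha> \<beta> t = exp (\<beta> * xi r \<alpha> t)"

definition ABCD_well_defined :: "real \<Rightarrow> real \<Rightarrow> real \<Rightarrow> real \<Rightarrow> bool" where
  "ABCD_well_defined r \<alpha> \<beta> t \<longleftrightarrow>
     (if t = 0 then 1 - \<beta> \<noteq> 0 else den r \<alpha> \<beta> t \<noteq> 0) \<and> A_rad r \<alpha> \<beta> t \<ge> 0 \<and> B_rad r \<alpha> \<beta> t \<ge> 0"

definition lyap_L ::
  "(real^'n \<Rightarrow> real) \<Rightarrow> real^'n \<Rightarrow> real \<Rightarrow> real \<Rightarrow> real \<Rightarrow> (real \<Rightarrow> real^'n) \<Rightarrow> (real \<Rightarrow> real^'n) \<Rightarrow> real \<Rightarrow> real" where
  "lyap_L f xs r \<alpha> \<beta> x v t =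
     1/2 * (norm (coeff_A r \<alpha> \<beta> t *\<^sub>R v t + coeff_B r \<alpha> \<beta> t *\<^sub>R (x t - xs)))\<^sup>2
     + 1/2 * coeff_C r \<alpha> \<beta> t * (norm (v t))\<^sup>2
     + coeff_D r \<alpha> \<beta> t * (f (x t) - f xs)"

definition lyapunov_from ::
  "(real^'n \<Rightarrow> real) \<Rightarrow> real^'n \<Rightarrow> real \<Rightarrow> real \<Rightarrow> real \<Rightarrow> real \<Rightarrow> bool" where
  "lyapunov_from f xs r \<alpha> \<beta> T \<longleftrightarrow>
     (\<forall>t\<in>time_domain \<alpha>. ABCD_well_defined r \<alpha> \<beta> t \<and>
        coeff_A r \<alpha> \<beta> t \<ge> 0 \<and> coeff_B r \<alpha> \<beta> t \<ge> 0 \<and> coeff_C r \<alpha> \<beta> t \<ge> 0 \<and> coeff_D r \<alpha> \<beta> t \<ge> 0) \<and>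
     (\<forall>J x v. ode_solution f r \<alpha> J x v \<longrightarrow>
        (\<forall>t\<in>J. t \<ge> T \<longrightarrow>
           (\<exists>L'. (lyap_L f xs r \<alpha> \<beta> x v has_real_derivative L') (at t within J) \<and> L' \<le> 0)))"

definition poly_P :: "real \<Rightarrow> real \<Rightarrow> real \<Rightarrow> real \<Rightarrow> real \<Rightarrow> real" where
  "poly_P \<mu> \<alpha> r \<beta> t =
     \<mu> * t\<^sup>2 - (1 - \<beta>) * \<beta> * r\<^sup>2 * rpow t (2 * (1 - \<alpha>))
     + (2 - 3 * \<beta>) * r * \<alpha> * rpow t (1 - \<alpha>) + \<alpha> * (\<alpha> + 1)"

definition T_last :: "real \<Rightarrow> real \<Rightarrow> real \<Rightarrow> real \<Rightarrow> real" where
  "T_last \<mu> \<alpha> r \<beta> =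
     (if \<alpha> = 0 then 0
      else if \<exists>t\<ge>0. poly_P \<mu> \<alpha> r \<beta> t = 0
      then (GREATEST t. t \<ge> 0 \<and> poly_P \<mu> \<alpha> r \<beta> t = 0)
      else 0)"

end

theory Submission
  imports Defs
begin

text \<open>
  Write \<open>y = x - x*\<close>, \<open>p(t) = r / t^\<alpha>\<close> and \<open>E(t) = exp (\<beta> \<xi>(t))\<close>. The square roots in the
  coefficients are an artefact of completing the square: since \<open>A^2 + C = E\<close> and
  \<open>A B = \<beta> p E\<close>, multiplying out gives, with \<open>K = A B\<close> and \<open>Q = B^2\<close>,
  \<open>L = 1/2 E |v|^2 + K \<langle>v, y\<rangle> + 1/2 Q |y|^2 + E (f x - f x*)\<close>
  (lemma \<open>lyap_L_expand\<close>). The three functions \<open>E\<close>, \<open>K\<close>, \<open>Q\<close> are tuned to the equation.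

  Because \<open>\<xi>' = p\<close>, we have \<open>E' = K\<close>, and \<open>Q\<close> is exactly the function with
  \<open>K' = p K - Q\<close>. Differentiating \<open>L\<close> along a solution and inserting
  \<open>v' = - p v - \<nabla>f x\<close>, the terms with \<open>\<langle>\<nabla>f x, v\<rangle>\<close> and with \<open>\<langle>v, y\<rangle>\<close> cancel, and
  \<open>L' = (3/2 \<beta> - 1) p E |v|^2 + K (f x - f x* - \<langle>\<nabla>f x, y\<rangle>) + 1/2 Q' |y|^2\<close>.
  The first term is nonpositive as \<open>\<beta> \<le> 2/3\<close>; strong convexity bounds the second by
  \<open>- \<mu>/2 K |y|^2\<close>. So \<open>L' \<le> 0\<close> as soon as \<open>Q' \<le> \<mu> K\<close>
  (lemma \<open>quadratic_energy_dissipation\<close>).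

  For \<open>t > 0\<close> the difference \<open>\<mu> K - Q'\<close> is a nonnegative factor times \<open>P(t)\<close>
  (lemma \<open>B_rad_deriv\<close>), which is where \<open>P\<close> comes from. For \<open>\<alpha> > 0\<close> it is eventually
  positive, so it cannot be negative after its largest root
  (lemma \<open>poly_P_nonneg_after_T_last\<close>). For \<open>\<alpha> = 0\<close> the same condition reads
  \<open>\<beta> (1 - \<beta>) r^2 \<le> \<mu>\<close>, which is the bound on \<open>r\<close>.

  What the bound on \<open>\<beta>\<close> adds to \<open>\<beta> \<le> 2/3\<close> is \<open>C \<ge> 0\<close>
  (lemma \<open>ratio_bounds\<close>).
\<close>

section \<open>Dissipation of a quadratic energy\<close>

text \<open>
  The condition on \<open>K'\<close> makes the mixed terms cancel: \<open>E' = K\<close> is the rate at which the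
  potential energy is weighted up, and \<open>K\<close> is also the weight with which \<open>\<langle>\<nabla>f x, x - xs\<rangle>\<close>
  enters through the equation, so strong convexity compares the two. What it gains is a
  multiple of \<open>|x - xs|^2\<close>, which has to pay for the growth of \<open>Q\<close>.
\<close>

lemma quadratic_energy_dissipation:
  fixes f :: "'a::real_inner \<Rightarrow> real" and x v :: "real \<Rightarrow> 'a"
  assumes f: "GDERIV f (x t) :> g"
    and x: "(x has_vector_derivative v t) (at t within J)"
    and v: "(v has_vector_derivative a) (at t within J)"
    and ode: "a + p *\<^sub>R v t + g = 0"
    and E: "(E has_real_derivative K t) (at t within J)"
    and K: "(K has_real_derivative p * K t - Q t) (at t within J)"
    and Q: "(Q has_real_derivative Q') (at t within J)"
    and K_eq: "K t = \<beta> * p * E t"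
    and signs: "0 \<le> E t" "0 \<le> p" "0 \<le> \<beta>" "\<beta> \<le> 2 / 3"
    and Q': "Q' \<le> \<mu> * K t"
    and conv: "f xs - f (x t) - inner g (xs - x t) \<ge> \<mu> / 2 * (norm (xs - x t))\<^sup>2"
  shows "\<exists>L'. ((\<lambda>s. 1/2 * E s * inner (v s) (v s) + K s * inner (v s) (x s - xs)
                + 1/2 * Q s * inner (x s - xs) (x s - xs) + E s * (f (x s) - f xs))
              has_real_derivative L') (at t within J) \<and> L' \<le> 0"
proof -
  define y where "y = x t - xs"
  define L' where "L' = - (1 - 3/2 * \<beta>) * p * E t * inner (v t) (v t)
     + K t * (f (x t) - f xs - inner g y) + 1/2 * Q' * inner y y"
  have a: "a = - p *\<^sub>R v t - g"
    using ode by (simp add: eq_diff_eq eq_neg_iff_add_eq_0 add_ac)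
  have fx: "((\<lambda>s. f (x s)) has_real_derivative inner g (v t)) (at t within J)"
    using has_derivative_compose[OF x[unfolded has_vector_derivative_def] f[unfolded gderiv_def]]
    by (simp add: has_field_derivative_def inner_commute mult.commute[of _ "inner g (v t)"] mult_commute_abs)
  have y: "((\<lambda>s. x s - xs) has_vector_derivative v t) (at t within J)"
    using x by (auto intro!: derivative_eq_intros)
  have inner_deriv: "((\<lambda>s. inner (h s) (k s)) has_real_derivative inner (h t) k' + inner h' (k t))
      (at t within J)"
    if "(h has_vector_derivative h') (at t within J)" "(k has_vector_derivative k') (at t within J)"
    for h k :: "real \<Rightarrow> 'a" and h' k'
    using has_derivative_inner[OF that[unfolded has_vector_derivative_def]]
    by (auto simp: has_field_derivative_def algebra_simps elim!: has_derivative_eq_rhs)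
  have "((\<lambda>s. 1/2 * E s * inner (v s) (v s) + K s * inner (v s) (x s - xs)
                + 1/2 * Q s * inner (x s - xs) (x s - xs) + E s * (f (x s) - f xs))
              has_real_derivative L') (at t within J)"
    apply (rule derivative_eq_intros inner_deriv[OF v v] inner_deriv[OF v y] inner_deriv[OF y y]
        E K Q fx refl)+
    by (simp add: L'_def a K_eq y_def[symmetric] inner_diff_left inner_diff_right inner_commute
        algebra_simps)
  moreover have "L' \<le> 0"
  proof -
    have K0: "0 \<le> K t" using K_eq signs by simp
    have "f (x t) - f xs - inner g y \<le> - (\<mu> / 2 * inner y y)"
      using conv by (simp add: y_def norm_minus_commute power2_norm_eq_inner inner_diff_right
          algebra_simps inner_commute)
    then have "K t * (f (x t) - f xs - inner g y) \<le> K t * (- (\<mu> / 2 * inner y y))"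
      using K0 by (rule mult_left_mono)
    moreover have "1/2 * Q' * inner y y \<le> 1/2 * (\<mu> * K t) * inner y y"
      using Q' by (intro mult_right_mono) auto
    moreover have "0 \<le> (1 - 3/2 * \<beta>) * p * E t * inner (v t) (v t)"
      using signs by (intro mult_nonneg_nonneg) auto
    ultimately show ?thesis unfolding L'_def by (simp add: algebra_simps)
  qed
  ultimately show ?thesis by blast
qed

section \<open>The coefficients\<close>

lemma rpow_eq_powr: "t > 0 \<Longrightarrow> rpow t p = t powr p"
  by (simp add: rpow_def)

lemma rpow_nonneg: "0 \<le> rpow t p"
  by (simp add: rpow_def)

lemma time_domain_cases:
  assumes "t \<in> time_domain \<alpha>"
  obtains (pos) "t > 0" | (start) "t = 0" "\<alpha> = 0"
  using assms by (cases "t = 0") (auto simp: time_domain_def split: if_splits)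

lemma den_pos:
  assumes "r > 0" "0 \<le> \<alpha>" "\<beta> < 1" "t > 0"
  shows "den r \<alpha> \<beta> t > 0"
  using assms by (simp add: den_def rpow_eq_powr add_pos_nonneg)

text \<open>
  The upper bound is \<open>(2 \<beta> - 1) r t^(1 - \<alpha>) \<le> \<alpha>\<close> after clearing the denominator. For
  \<open>\<alpha> < 1\<close> the power of \<open>t\<close> is unbounded, which forces \<open>\<beta> \<le> 1/2\<close>; for \<open>\<alpha> = 1\<close> it is
  constant and some room above \<open>1/2\<close> remains.
\<close>

lemma ratio_bounds:
  assumes "r > 0" "0 \<le> \<alpha>" "\<alpha> \<le> 1" "0 \<le> \<beta>"
    and \<beta>: "\<beta> \<le> (if \<alpha> < 1 then 1/2 else min (2/3) ((1 + r) / (2 * r)))"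
    and "t \<in> time_domain \<alpha>"
  shows "0 \<le> ratio r \<alpha> \<beta> t" "ratio r \<alpha> \<beta> t \<le> 1"
proof -
  have \<beta>1: "\<beta> < 1" using \<beta> by (auto split: if_splits)
  have "0 \<le> ratio r \<alpha> \<beta> t \<and> ratio r \<alpha> \<beta> t \<le> 1"
    using assms(6)
  proof (cases rule: time_domain_cases)
    case pos
    have d: "den r \<alpha> \<beta> t > 0" using den_pos assms \<beta>1 pos by blast
    have "\<beta> * r * rpow t (1 - \<alpha>) \<le> den r \<alpha> \<beta> t"
    proof (cases "\<alpha> < 1")
      case True
      then have "\<beta> * (r * rpow t (1 - \<alpha>)) \<le> (1 - \<beta>) * (r * rpow t (1 - \<alpha>))"
        using \<beta> \<open>r > 0\<close> by (intro mult_right_mono mult_nonneg_nonneg rpow_nonneg) auto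
      then show ?thesis using \<open>0 \<le> \<alpha>\<close> by (simp add: den_def mult.assoc)
    next
      case False
      then have "\<alpha> = 1" "\<beta> \<le> (1 + r) / (2 * r)" using \<beta> \<open>\<alpha> \<le> 1\<close> by auto
      then show ?thesis using \<open>r > 0\<close> by (simp add: den_def rpow_def field_simps)
    qed
    then show ?thesis using d pos assms rpow_nonneg[of t "1 - \<alpha>"] by (simp add: ratio_def)
  next
    case start
    then show ?thesis using assms \<beta>1 by (simp add: ratio_def)
  qed
  then show "0 \<le> ratio r \<alpha> \<beta> t" "ratio r \<alpha> \<beta> t \<le> 1" by auto
qed

lemma B_rad_nonneg:
  assumes "r > 0" "0 \<le> \<alpha>" "0 \<le> \<beta>" "\<beta> < 1" "t \<in> time_domain \<alpha>"
  shows "0 \<le> B_rad r \<alpha> \<beta> t"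
  using assms(5)
proof (cases rule: time_domain_cases)
  case pos
  then show ?thesis using den_pos[of r \<alpha> \<beta> t] assms
    by (simp add: B_rad_def rpow_nonneg)
qed (use assms in \<open>simp add: B_rad_def\<close>)

definition cross_coeff :: "real \<Rightarrow> real \<Rightarrow> real \<Rightarrow> real \<Rightarrow> real" where
  "cross_coeff r \<alpha> \<beta> t = \<beta> * (r / rpow t \<alpha>) * exp (\<beta> * xi r \<alpha> t)"

text \<open>
  The factor \<open>(1 - \<beta>) r t^(1 - \<alpha>) + \<alpha>\<close> is the denominator of \<open>A^2\<close> and a factor of \<open>B^2\<close>,
  so the product of the radicands is a perfect square.
\<close>

lemma A_mult_B:
  assumes "r > 0" "0 \<le> \<alpha>" "0 \<le> \<beta>" "\<beta> < 1" "t \<in> time_domain \<alpha>"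
  shows "coeff_A r \<alpha> \<beta> t * coeff_B r \<alpha> \<beta> t = cross_coeff r \<alpha> \<beta> t"
proof -
  have "A_rad r \<alpha> \<beta> t * B_rad r \<alpha> \<beta> t = (cross_coeff r \<alpha> \<beta> t)\<^sup>2"
    using assms(5)
  proof (cases rule: time_domain_cases)
    case pos
    have d: "den r \<alpha> \<beta> t > 0" using den_pos assms pos by blast
    have "rpow t (1 - \<alpha>) * rpow t (- \<alpha> - 1) = (1 / rpow t \<alpha>)\<^sup>2"
      using pos by (simp add: rpow_eq_powr powr_minus_divide[symmetric] power2_eq_square
          powr_add[symmetric] divide_powr_uminus)
    moreover have "A_rad r \<alpha> \<beta> t * B_rad r \<alpha> \<beta> t
        = (\<beta> * r * exp (\<beta> * xi r \<alpha> t))\<^sup>2 * (rpow t (1 - \<alpha>) * rpow t (- \<alpha> - 1))"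
      using d pos by (simp add: A_rad_def B_rad_def ratio_def power2_eq_square)
    ultimately show ?thesis
      by (simp add: cross_coeff_def power2_eq_square)
  next
    case start
    then show ?thesis using assms
      by (simp add: A_rad_def B_rad_def ratio_def cross_coeff_def rpow_def power2_eq_square)
  qed
  moreover have "0 \<le> cross_coeff r \<alpha> \<beta> t"
    using assms by (simp add: cross_coeff_def rpow_nonneg)
  ultimately show ?thesis
    by (simp add: coeff_A_def coeff_B_def real_sqrt_mult[symmetric])
qed

lemma lyap_L_expand:
  assumes "r > 0" "0 \<le> \<alpha>" "\<alpha> \<le> 1" "0 \<le> \<beta>"
    and \<beta>: "\<beta> \<le> (if \<alpha> < 1 then 1/2 else min (2/3) ((1 + r) / (2 * r)))"
    and t: "t \<in> time_domain \<alpha>"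
  shows "lyap_L f xs r \<alpha> \<beta> x v t
     = 1/2 * exp (\<beta> * xi r \<alpha> t) * inner (v t) (v t)
       + cross_coeff r \<alpha> \<beta> t * inner (v t) (x t - xs)
       + 1/2 * B_rad r \<alpha> \<beta> t * inner (x t - xs) (x t - xs)
       + exp (\<beta> * xi r \<alpha> t) * (f (x t) - f xs)"
proof -
  have \<beta>1: "\<beta> < 1" using \<beta> by (auto split: if_splits)
  let ?A = "coeff_A r \<alpha> \<beta> t" and ?B = "coeff_B r \<alpha> \<beta> t"
  have A: "?A * ?A = A_rad r \<alpha> \<beta> t"
    using ratio_bounds[OF assms] by (simp add: coeff_A_def A_rad_def)
  have AC: "?A * ?A + coeff_C r \<alpha> \<beta> t = exp (\<beta> * xi r \<alpha> t)"
    unfolding A by (simp add: A_rad_def coeff_C_def algebra_simps)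
  have B: "?B * ?B = B_rad r \<alpha> \<beta> t"
    using B_rad_nonneg[OF assms(1,2,4) \<beta>1 t] by (simp add: coeff_B_def)
  have "(norm (?A *\<^sub>R v t + ?B *\<^sub>R (x t - xs)))\<^sup>2
      = (?A * ?A) * inner (v t) (v t) + 2 * (?A * ?B) * inner (v t) (x t - xs)
        + (?B * ?B) * inner (x t - xs) (x t - xs)"
    by (simp only: power2_norm_eq_inner inner_add_left inner_add_right inner_scaleR_left
        inner_scaleR_right inner_commute[of "x t - xs" "v t"]) (simp add: algebra_simps)
  then show ?thesis
    unfolding lyap_L_def coeff_D_def power2_norm_eq_inner[of "v t"] B
      A_mult_B[OF assms(1,2,4) \<beta>1 t] AC[symmetric]
    by (simp only:) (simp add: distrib_left distrib_right)
qed

section \<open>Their derivatives\<close>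

lemma xi_deriv:
  assumes "0 \<le> \<alpha>" "\<alpha> \<le> 1" "t \<in> J" "J \<subseteq> time_domain \<alpha>"
  shows "(xi r \<alpha> has_real_derivative r / rpow t \<alpha>) (at t within J)"
proof (cases "\<alpha> = 0")
  case True
  have "((\<lambda>s. r * s) has_real_derivative r / rpow t \<alpha>) (at t within J)"
    using True by (auto intro!: derivative_eq_intros simp: rpow_def)
  then show ?thesis
    by (rule has_field_derivative_transform_within[where d = 1])
      (use assms True in \<open>auto simp: xi_def rpow_def time_domain_def\<close>)
next
  case False
  then have pos: "s \<in> J \<Longrightarrow> s > 0" for s using assms by (auto simp: time_domain_def)
  show ?thesis
  proof (cases "\<alpha> = 1")
    case True
    have "((\<lambda>s. r * ln s) has_real_derivative r / rpow t \<alpha>) (at t within J)"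
      using True pos[OF \<open>t \<in> J\<close>] by (auto intro!: derivative_eq_intros simp: rpow_def)
    then show ?thesis
      by (rule has_field_derivative_transform_within[where d = 1])
        (use assms True in \<open>auto simp: xi_def\<close>)
  next
    case False
    have "((\<lambda>s. r / (1 - \<alpha>) * s powr (1 - \<alpha>)) has_real_derivative r / rpow t \<alpha>) (at t within J)"
      using False pos[OF \<open>t \<in> J\<close>]
      by (auto intro!: derivative_eq_intros simp: rpow_eq_powr powr_minus_divide)
    then show ?thesis
      by (rule has_field_derivative_transform_within[where d = 1])
        (use assms False pos in \<open>auto simp: xi_def rpow_eq_powr\<close>)
  qed
qed

lemma exp_xi_deriv:
  assumes "0 \<le> \<alpha>" "\<alpha> \<le> 1" "t \<in> J" "J \<subseteq> time_domain \<alpha>"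
  shows "((\<lambda>s. exp (\<beta> * xi r \<alpha> s)) has_real_derivative cross_coeff r \<alpha> \<beta> t) (at t within J)"
  by (rule derivative_eq_intros xi_deriv[OF assms] refl)+ (simp add: cross_coeff_def)

lemma B_rad_pos_time:
  assumes "t > 0"
  shows "B_rad r \<alpha> \<beta> t = \<beta> * r * ((1 - \<beta>) * r * t powr (-2 * \<alpha>) + \<alpha> * t powr (- \<alpha> - 1))
           * exp (\<beta> * xi r \<alpha> t)"
proof -
  have "t powr (1 - \<alpha>) * t powr (- \<alpha> - 1) = t powr (-2 * \<alpha>)"
    by (simp add: powr_add[symmetric])
  then show ?thesis
    using assms by (simp add: B_rad_def den_def rpow_eq_powr algebra_simps)
qed

lemma B_rad_constant_damping:
  assumes "t \<ge> 0"
  shows "B_rad r 0 \<beta> t = \<beta> * (1 - \<beta>) * r\<^sup>2 * exp (\<beta> * xi r 0 t)"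
  using assms B_rad_pos_time[of t r 0 \<beta>]
  by (cases "t = 0") (auto simp: B_rad_def power2_eq_square)

text \<open>
  This identity is the reason for the choice of \<open>B\<close>: its square is what cancels the mixed
  term \<open>\<langle>v, x - x*\<rangle>\<close> in \<open>L'\<close>. For \<open>\<alpha> = 0\<close> the interval may contain the time \<open>0\<close>; the
  damping is then constant, and only an exponential has to be differentiated.
\<close>

lemma cross_coeff_deriv:
  assumes "0 \<le> \<alpha>" "\<alpha> \<le> 1" "t \<in> J" "J \<subseteq> time_domain \<alpha>"
  shows "(cross_coeff r \<alpha> \<beta> has_real_derivative
            r / rpow t \<alpha> * cross_coeff r \<alpha> \<beta> t - B_rad r \<alpha> \<beta> t) (at t within J)"
proof (cases "\<alpha> = 0")
  case True
  have eq: "cross_coeff r \<alpha> \<beta> = (\<lambda>s. \<beta> * r * exp (\<beta> * xi r \<alpha> s))"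
    using True by (simp add: cross_coeff_def rpow_def fun_eq_iff)
  have t: "t \<ge> 0" using assms True by (auto simp: time_domain_def)
  have "((\<lambda>s. \<beta> * r * exp (\<beta> * xi r \<alpha> s)) has_real_derivative \<beta> * r * cross_coeff r \<alpha> \<beta> t)
      (at t within J)"
    by (rule DERIV_cmult exp_xi_deriv assms)+
  then show ?thesis
    unfolding eq[symmetric] using True t
    by (simp add: B_rad_constant_damping cross_coeff_def rpow_def power2_eq_square algebra_simps)
next
  case False
  then have pos: "s \<in> J \<Longrightarrow> s > 0" for s using assms by (auto simp: time_domain_def)
  then have t: "t > 0" using assms by auto
  have sq: "t powr (-2 * \<alpha>) = t powr - \<alpha> * t powr - \<alpha>"
    by (simp add: powr_add[symmetric])
  have inv: "r / t powr \<alpha> = r * t powr - \<alpha>"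
    by (simp add: powr_minus divide_inverse)
  have "((\<lambda>s. \<beta> * (r * s powr (- \<alpha>)) * exp (\<beta> * xi r \<alpha> s)) has_real_derivative
            r / rpow t \<alpha> * cross_coeff r \<alpha> \<beta> t - B_rad r \<alpha> \<beta> t) (at t within J)"
    apply (rule derivative_eq_intros xi_deriv[OF assms] refl t)+
    apply (simp only: B_rad_pos_time[OF t] sq inv cross_coeff_def rpow_eq_powr[OF t])
    by (simp add: algebra_simps)
  then show ?thesis
    by (rule has_field_derivative_transform_within[where d = 1])
      (use assms pos in \<open>auto simp: cross_coeff_def rpow_eq_powr powr_minus divide_inverse\<close>)
qed

text \<open>
  The origin of \<open>P\<close>: for \<open>\<beta> > 0\<close>, dividing \<open>\<mu> K - Q'\<close> by \<open>\<beta> r E\<close> and multiplying by \<open>t^(\<alpha> + 2)\<close> clears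
  all negative powers of \<open>t\<close>.
\<close>

lemma B_rad_deriv:
  assumes "0 \<le> \<alpha>" "\<alpha> \<le> 1" "t \<in> J" "J \<subseteq> {0<..}"
  shows "(B_rad r \<alpha> \<beta> has_real_derivative
            \<mu> * cross_coeff r \<alpha> \<beta> t
            - \<beta> * r * t powr (- \<alpha> - 2) * exp (\<beta> * xi r \<alpha> t) * poly_P \<mu> \<alpha> r \<beta> t) (at t within J)"
proof -
  have pos: "s \<in> J \<Longrightarrow> s > 0" for s using assms by auto
  then have t: "t > 0" using assms by auto
  have J: "J \<subseteq> time_domain \<alpha>" using assms by (auto simp: time_domain_def)
  define u w where "u = t powr - \<alpha>" and "w = 1 / t"
  have u: "u > 0" using t by (simp add: u_def)
  \<comment> \<open>All exponents are integer combinations of \<open>1\<close> and \<open>\<alpha>\<close>, so in terms of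
    \<open>t\<close> and \<open>u\<close> the identity becomes one between rational functions.\<close>
  have powers: "t powr \<alpha> = 1 / u" "t powr (-2 * \<alpha>) = u * u" "t powr (- \<alpha> - 1) = u * w"
    "t powr (- \<alpha> - 2) = u * w * w" "t powr (-2 * \<alpha> - 1) = u * u * w"
    "t powr (- \<alpha> - 1 - 1) = u * w * w"
    "t powr (1 - \<alpha>) = t * u" "t powr (2 * (1 - \<alpha>)) = t * t * u * u"
    using t by (simp_all add: u_def w_def powr_diff powr_minus powr_add field_simps
        power2_eq_square powr_add[symmetric] flip: powr_mult_base)
  have "((\<lambda>s. \<beta> * r * ((1 - \<beta>) * r * s powr (-2 * \<alpha>) + \<alpha> * s powr (- \<alpha> - 1))
           * exp (\<beta> * xi r \<alpha> s)) has_real_derivative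
          \<mu> * cross_coeff r \<alpha> \<beta> t
            - \<beta> * r * t powr (- \<alpha> - 2) * exp (\<beta> * xi r \<alpha> t) * poly_P \<mu> \<alpha> r \<beta> t) (at t within J)"
    apply (rule derivative_eq_intros xi_deriv[OF assms(1-3) J] refl t)+
    apply (simp only: cross_coeff_def poly_P_def rpow_eq_powr[OF t] powers)
    using t u by (simp add: w_def field_simps power2_eq_square)
  then show ?thesis
    by (rule has_field_derivative_transform_within[where d = 1])
      (use assms pos B_rad_pos_time in auto)
qed

text \<open>
  At \<open>t = 0\<close> the condition \<open>P(t) \<ge> 0\<close> is void, since \<open>P(t)\<close> is a multiple of \<open>t^2\<close> when
  \<open>\<alpha> = 0\<close>. The derivative without that factor covers the initial time as well.
\<close>

lemma B_rad_deriv_constant_damping: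
  assumes "t \<in> J" "J \<subseteq> {0..}"
  shows "(B_rad r 0 \<beta> has_real_derivative
            \<beta> * (1 - \<beta>) * r\<^sup>2 * cross_coeff r 0 \<beta> t) (at t within J)"
proof -
  have "((\<lambda>s. \<beta> * (1 - \<beta>) * r\<^sup>2 * exp (\<beta> * xi r 0 s)) has_real_derivative
            \<beta> * (1 - \<beta>) * r\<^sup>2 * cross_coeff r 0 \<beta> t) (at t within J)"
    by (intro DERIV_cmult exp_xi_deriv) (use assms in \<open>auto simp: time_domain_def\<close>)
  then show ?thesis
    by (rule has_field_derivative_transform_within[where d = 1])
      (use assms B_rad_constant_damping in auto)
qed

section \<open>The threshold time\<close>

lemma continuous_on_rpow:
  assumes "0 \<le> p"
  shows "continuous_on {0..} (\<lambda>t. rpow t p)"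
proof (cases "p = 0")
  case False
  then have "continuous_on {0..} (\<lambda>t. t powr p)"
    using assms by (intro continuous_on_powr' continuous_on_id continuous_on_const) auto
  then show ?thesis using False by (simp add: rpow_def)
qed (simp add: rpow_def)

text \<open>
  As \<open>\<alpha> > 0\<close>, the only negative term of \<open>P\<close> has an exponent below \<open>2\<close> and is eventually
  dominated by \<open>\<mu> t^2\<close>.
\<close>

lemma poly_P_eventually_pos:
  assumes "\<mu> > 0" "r > 0" "0 < \<alpha>" "0 \<le> \<beta>" "\<beta> \<le> 2 / 3"
  shows "\<exists>M>0. \<forall>t\<ge>M. 0 < poly_P \<mu> \<alpha> r \<beta> t"
proof -
  define k where "k = (1 - \<beta>) * \<beta> * r\<^sup>2"
  have "((\<lambda>t. k * t powr (- 2 * \<alpha>)) \<longlongrightarrow> k * 0) at_top"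
    by (intro tendsto_mult_left tendsto_neg_powr filterlim_ident) (use assms in auto)
  then have "\<forall>\<^sub>F t in at_top. k * t powr (- 2 * \<alpha>) < \<mu>"
    using assms by (intro order_tendstoD) auto
  then obtain M where M: "\<And>t. t \<ge> M \<Longrightarrow> k * t powr (- 2 * \<alpha>) < \<mu>"
    by (auto simp: eventually_at_top_linorder)
  have "0 < poly_P \<mu> \<alpha> r \<beta> t" if "t \<ge> max M 1" for t
  proof -
    have t: "t > 0" "t \<ge> M" using that by auto
    have "t\<^sup>2 * t powr (- 2 * \<alpha>) = t powr (2 * (1 - \<alpha>))"
      using t by (simp add: powr_add[symmetric] flip: powr_numeral)
    then have "k * t powr (2 * (1 - \<alpha>)) = t\<^sup>2 * (k * t powr (- 2 * \<alpha>))" by simp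
    also have "\<dots> < t\<^sup>2 * \<mu>" using M[OF t(2)] t by (intro mult_strict_left_mono) auto
    finally have "k * t powr (2 * (1 - \<alpha>)) < \<mu> * t\<^sup>2" by (simp add: mult.commute)
    moreover have "0 \<le> (2 - 3 * \<beta>) * r * \<alpha> * rpow t (1 - \<alpha>)"
      using assms by (simp add: rpow_nonneg)
    moreover have "0 \<le> \<alpha> * (\<alpha> + 1)" using assms by simp
    ultimately show ?thesis
      unfolding poly_P_def k_def[symmetric] using t by (simp add: rpow_eq_powr)
  qed
  then show ?thesis by (intro exI[of _ "max M 1"]) auto
qed

text \<open>
  If \<open>P\<close> were negative at \<open>t\<close>, the intermediate value theorem would yield a root beyond
  \<open>t\<close>. The set of roots is compact, so its largest element exists and lies beyond \<open>t\<close> too,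
  contradicting \<open>t \<ge> T\<close>.
\<close>

lemma poly_P_nonneg_after_T_last:
  assumes "\<mu> > 0" "r > 0" "0 < \<alpha>" "\<alpha> \<le> 1" "0 \<le> \<beta>" "\<beta> \<le> 2 / 3"
    and "0 \<le> t" "T_last \<mu> \<alpha> r \<beta> \<le> t"
  shows "0 \<le> poly_P \<mu> \<alpha> r \<beta> t"
proof (rule ccontr)
  let ?P = "poly_P \<mu> \<alpha> r \<beta>"
  let ?Z = "{t. t \<ge> 0 \<and> ?P t = 0}"
  assume neg: "\<not> 0 \<le> ?P t"
  obtain M where M: "M > 0" "\<And>s. s \<ge> M \<Longrightarrow> 0 < ?P s"
    using poly_P_eventually_pos assms by blast
  have cont: "continuous_on {0..} ?P"
    unfolding poly_P_def using assms
    by (intro continuous_intros continuous_on_rpow) auto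
  have "t < M" using neg M(2)[of t] by force
  then have "\<exists>s\<ge>t. s \<le> M \<and> ?P s = 0"
    using neg M(2)[of M] assms
    by (intro IVT') (auto intro: continuous_on_subset[OF cont])
  then obtain s where s: "s \<ge> t" "s \<in> ?Z" using \<open>0 \<le> t\<close> by auto
  have "s \<noteq> t" using s neg by auto
  have "?Z \<subseteq> {0..M}"
  proof
    fix s assume "s \<in> ?Z"
    then show "s \<in> {0..M}" using M(2)[of s] by (cases "M \<le> s") auto
  qed
  moreover have "closed ?Z"
    using continuous_closed_preimage_constant[OF cont, of 0] by simp
  ultimately have "compact ?Z"
    by (meson bounded_closed_interval bounded_subset compact_eq_bounded_closed)
  then obtain z where z: "z \<in> ?Z" "\<And>y. y \<in> ?Z \<Longrightarrow> y \<le> z"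
    using compact_attains_sup[of ?Z] s by blast
  then have "(GREATEST t. t \<ge> 0 \<and> ?P t = 0) = z"
    by (intro Greatest_equality) auto
  then have "T_last \<mu> \<alpha> r \<beta> = z" using assms s by (auto simp: T_last_def)
  then show False using z(2)[OF s(2)] s(1) \<open>s \<noteq> t\<close> assms by simp
qed

section \<open>The Lyapunov function\<close>

lemma B_rad_deriv_bound:
  assumes "\<mu> > 0" "r > 0" "0 \<le> \<alpha>" "\<alpha> \<le> 1" "0 \<le> \<beta>" "\<beta> \<le> 2 / 3"
    and restr: "\<alpha> = 0 \<Longrightarrow> \<beta> \<noteq> 0 \<Longrightarrow> r \<le> sqrt (\<mu> / (\<beta> * (1 - \<beta>)))"
    and t: "t \<in> J" "J \<subseteq> time_domain \<alpha>" "T_last \<mu> \<alpha> r \<beta> \<le> t"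
  shows "\<exists>Q'. (B_rad r \<alpha> \<beta> has_real_derivative Q') (at t within J)
              \<and> Q' \<le> \<mu> * cross_coeff r \<alpha> \<beta> t"
proof (cases "\<alpha> = 0")
  case True
  have "\<beta> * (1 - \<beta>) * r\<^sup>2 \<le> \<mu>"
  proof (cases "\<beta> = 0")
    case False
    then have c: "0 < \<beta> * (1 - \<beta>)" using assms by simp
    have "r\<^sup>2 \<le> (sqrt (\<mu> / (\<beta> * (1 - \<beta>))))\<^sup>2"
      using restr True False assms by (intro power_mono) auto
    also have "\<dots> = \<mu> / (\<beta> * (1 - \<beta>))"
      using c \<open>\<mu> > 0\<close> by (intro real_sqrt_pow2) simp
    finally show ?thesis using c by (simp add: pos_le_divide_eq mult.commute)
  qed (use assms in simp)
  moreover have "0 \<le> cross_coeff r \<alpha> \<beta> t"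
    using assms by (simp add: cross_coeff_def rpow_nonneg)
  ultimately have "\<beta> * (1 - \<beta>) * r\<^sup>2 * cross_coeff r \<alpha> \<beta> t \<le> \<mu> * cross_coeff r \<alpha> \<beta> t"
    by (rule mult_right_mono)
  then show ?thesis
    using B_rad_deriv_constant_damping[of t J r \<beta>] t True by (auto simp: time_domain_def)
next
  case False
  then have J: "J \<subseteq> {0<..}" using t by (simp add: time_domain_def)
  then have "0 \<le> t" using t by auto
  then have "0 \<le> poly_P \<mu> \<alpha> r \<beta> t"
    using poly_P_nonneg_after_T_last assms False by simp
  then have "0 \<le> \<beta> * r * t powr (- \<alpha> - 2) * exp (\<beta> * xi r \<alpha> t) * poly_P \<mu> \<alpha> r \<beta> t"
    using assms by simp
  then show ?thesis using B_rad_deriv[OF assms(3,4) t(1) J, of r \<beta> \<mu>] by fastforce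
qed

theorem theorem1p2:
  fixes f :: "real^'n \<Rightarrow> real" and xs :: "real^'n" and \<mu> r \<alpha> \<beta> :: real
  assumes "twice_cont_differentiable f"
    and "convex_on UNIV f"
    and "\<exists>K. K-lipschitz_on UNIV (grad f)"
    and "unique_minimizer f xs"
    and "\<mu> > 0"
    and "strongly_convex \<mu> f"
    and "r > 0"
    and "0 \<le> \<alpha>" and "\<alpha> \<le> 1"
    and "0 \<le> \<beta>"
    and "\<beta> \<le> (if \<alpha> < 1 then 1/2 else min (2/3) ((1 + r) / (2 * r)))"
    and "\<alpha> = 0 \<Longrightarrow> \<beta> \<noteq> 0 \<Longrightarrow> r \<le> sqrt (\<mu> / (\<beta> * (1 - \<beta>)))"
  shows "lyapunov_from f xs r \<alpha> \<beta> (T_last \<mu> \<alpha> r \<beta>)"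
proof -
  have \<beta>: "\<beta> \<le> 2 / 3" "\<beta> < 1" using assms(11) by (auto split: if_splits)
  have coeffs: "ABCD_well_defined r \<alpha> \<beta> t \<and> coeff_A r \<alpha> \<beta> t \<ge> 0 \<and> coeff_B r \<alpha> \<beta> t \<ge> 0
      \<and> coeff_C r \<alpha> \<beta> t \<ge> 0 \<and> coeff_D r \<alpha> \<beta> t \<ge> 0"
    if t: "t \<in> time_domain \<alpha>" for t
  proof -
    note rb = ratio_bounds[OF assms(7-11) t]
    note B = B_rad_nonneg[OF assms(7,8,10) \<beta>(2) t]
    have "t \<noteq> 0 \<Longrightarrow> den r \<alpha> \<beta> t \<noteq> 0"
      using den_pos[OF assms(7,8) \<beta>(2), of t] t
      by (force elim: time_domain_cases)
    then show ?thesis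
      using rb B \<beta> by (simp add: ABCD_well_defined_def A_rad_def coeff_A_def coeff_B_def
          coeff_C_def coeff_D_def)
  qed
  have "\<exists>L'. (lyap_L f xs r \<alpha> \<beta> x v has_real_derivative L') (at t within J) \<and> L' \<le> 0"
    if sol: "ode_solution f r \<alpha> J x v" and t: "t \<in> J" "t \<ge> T_last \<mu> \<alpha> r \<beta>" for J x v t
  proof -
    obtain a where J: "J \<subseteq> time_domain \<alpha>"
      and x: "(x has_vector_derivative v t) (at t within J)"
      and v: "(v has_vector_derivative a t) (at t within J)"
      and ode: "a t + (r / rpow t \<alpha>) *\<^sub>R v t + grad f (x t) = 0"
      using sol t unfolding ode_solution_def by blast
    obtain Q' where Q': "(B_rad r \<alpha> \<beta> has_real_derivative Q') (at t within J)"
        "Q' \<le> \<mu> * cross_coeff r \<alpha> \<beta> t"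
      using B_rad_deriv_bound[OF assms(5,7-10) \<beta>(1) assms(12) t(1) J t(2)] by blast
    have g: "GDERIV f (x t) :> grad f (x t)"
      using assms(1) by (simp add: twice_cont_differentiable_def)
    obtain L' where L': "((\<lambda>s. 1/2 * exp (\<beta> * xi r \<alpha> s) * inner (v s) (v s)
          + cross_coeff r \<alpha> \<beta> s * inner (v s) (x s - xs)
          + 1/2 * B_rad r \<alpha> \<beta> s * inner (x s - xs) (x s - xs)
          + exp (\<beta> * xi r \<alpha> s) * (f (x s) - f xs)) has_real_derivative L') (at t within J)"
        "L' \<le> 0"
      using quadratic_energy_dissipation[OF g x v ode exp_xi_deriv[OF assms(8,9) t(1) J]
          cross_coeff_deriv[OF assms(8,9) t(1) J] Q'(1) _ _ _ assms(10) \<beta>(1) Q'(2), of xs]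
        assms(6,7) by (auto simp: cross_coeff_def rpow_nonneg strongly_convex_def)
    have "(lyap_L f xs r \<alpha> \<beta> x v has_real_derivative L') (at t within J)"
      by (rule has_field_derivative_transform_within[OF L'(1) zero_less_one t(1)],
          rule lyap_L_expand[OF assms(7-11), symmetric]) (use J in auto)
    then show ?thesis using L'(2) by blast
  qed
  then show ?thesis unfolding lyapunov_from_def using coeffs by blast
qed

end
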